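(* Let $G=(V_1\cup V_2,E)$ be a bipartite graph with bipartition $(V_1,V_2)$, with maximum degree $\Delta(G)$ and with no isolated vertices. Put $\Delta_{V_1}=\max\{d(u): u\in V_1\}$ and $\Delta_{V_2}=\max\{d(u): u\in V_2\}$. Then $$\chi'_{\mathrm{inj}}(G)\leq\begin{cases}\min\{\Delta_{V_1}(\Delta_{V_2}-1),\ \Delta_{V_2}(\Delta_{V_1}-1)\}+1 & \text{if } \Delta(G)\geq 3,\\ 3 & \text{if } \Delta(G)=2.\end{cases}$$
   Context: All graphs are finite and simple; $d(u)$ denotes the degree of $u$ in $G$. Three edges $e_1,e_2,e_3$ of a graph are consecutive if they form (in this order) a path of length three or a cycle of length three. An injective edge-coloring of $G$ with $k$ colors is a map $c:E(G)\to\{1,\dots,k\}$ (not necessarily a proper edge-coloring) such that $c(e_1)\neq c(e_3)$ whenever $e_1,e_2,e_3$ are consecutive edges in $G$. The injective chromatic index $\chi'_{\mathrm{inj}}(G)$ is the minimum $k$ such that $G$ has an injective edge-coloring with $k$ colors. *)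

theory Defs
  imports Complex_Main
begin

definition simple_graph :: "'a set \<Rightarrow> 'a set set \<Rightarrow> bool" where
  "simple_graph V E \<longleftrightarrow> finite V \<and> (\<forall>e\<in>E. e \<subseteq> V \<and> card e = 2)"

definition bipartition :: "'a set set \<Rightarrow> 'a set \<Rightarrow> 'a set \<Rightarrow> bool" where
  "bipartition E V1 V2 \<longleftrightarrow> V1 \<inter> V2 = {} \<and> (\<forall>e\<in>E. \<exists>u\<in>V1. \<exists>v\<in>V2. e = {u, v})"

definition degree :: "'a set set \<Rightarrow> 'a \<Rightarrow> nat" where
  "degree E u = card {e \<in> E. u \<in> e}"

text \<open>For a finite nonempty set of vertices this supremum of natural numbers is a maximum;
  for the empty set it is 0.\<close>

definition max_degree :: "'a set set \<Rightarrow> 'a set \<Rightarrow> nat" where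
  "max_degree E S = (SUP u\<in>S. degree E u)"

text \<open>The first alternative is a path of length three, the second a triangle.\<close>

definition consecutive :: "'a set set \<Rightarrow> 'a set \<Rightarrow> 'a set \<Rightarrow> 'a set \<Rightarrow> bool" where
  "consecutive E e1 e2 e3 \<longleftrightarrow>
     e1 \<in> E \<and> e2 \<in> E \<and> e3 \<in> E \<and>
     ((\<exists>a b c d. distinct [a, b, c, d] \<and> e1 = {a, b} \<and> e2 = {b, c} \<and> e3 = {c, d}) \<or>
      (\<exists>a b c. distinct [a, b, c] \<and> e1 = {a, b} \<and> e2 = {b, c} \<and> e3 = {c, a}))"

definition injective_edge_coloring :: "'a set set \<Rightarrow> nat \<Rightarrow> ('a set \<Rightarrow> nat) \<Rightarrow> bool" where
  "injective_edge_coloring E k col \<longleftrightarrow>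
     col ` E \<subseteq> {1..k} \<and>
     (\<forall>e1 e2 e3. consecutive E e1 e2 e3 \<longrightarrow> col e1 \<noteq> col e3)"

definition injective_chromatic_index :: "'a set set \<Rightarrow> nat" where
  "injective_chromatic_index E = (LEAST k. \<exists>col. injective_edge_coloring E k col)"

text \<open>The minimum is attained for every finite simple graph: give all edges different colors.\<close>

lemma injective_edge_coloring_exists:
  assumes "simple_graph V E"
  shows "\<exists>k col. injective_edge_coloring E k col"
proof -
  have "E \<subseteq> Pow V" and "finite V"
    using assms by (auto simp: simple_graph_def)
  then have "finite E"
    by (meson finite_Pow_iff finite_subset)
  then obtain h where h: "bij_betw h E {1..card E}"
    using finite_same_card_bij[of E "{1..card E}"] by auto
  have "h e1 \<noteq> h e3" if "consecutive E e1 e2 e3" for e1 e2 e3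
  proof -
    have "e1 \<in> E" "e3 \<in> E" "e1 \<noteq> e3"
      using that by (auto simp: consecutive_def doubleton_eq_iff)
    then show ?thesis
      using h by (auto simp: bij_betw_def inj_on_def)
  qed
  then have "injective_edge_coloring E (card E) h"
    using h by (auto simp: injective_edge_coloring_def bij_betw_def)
  then show ?thesis by blast
qed

end

theory Submission
  imports Defs
begin

text \<open>Color every edge by its endpoint in \<open>V1\<close>. The first and third of three consecutive edges
  have distinct endpoints in \<open>V1\<close> with a common neighbor in \<open>V2\<close>, so it suffices to color the
  graph on \<open>V1\<close> that joins vertices with a common neighbor. Its degrees are at most
  \<open>\<Delta>\<^bsub>V1\<^esub>(\<Delta>\<^bsub>V2\<^esub> - 1)\<close>, and a greedy coloring works. Exchanging the sides gives the minimum; if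
  \<open>\<Delta> = 2\<close>, the bound is at most 3.\<close>

text \<open>Induction on \<open>V\<close>: the degree bound passes to subsets, and the vertex
  inserted last sees at most \<open>d\<close> of the \<open>d + 1\<close> colors, so one is left for
  it.\<close>

lemma greedy_coloring:
  fixes R :: "'a \<Rightarrow> 'a \<Rightarrow> bool"
  assumes "finite V" and "symp R"
    and "\<And>u. u \<in> V \<Longrightarrow> card {w \<in> V. w \<noteq> u \<and> R u w} \<le> d"
  shows "\<exists>c. c ` V \<subseteq> {1..d + 1} \<and> (\<forall>u\<in>V. \<forall>w\<in>V. u \<noteq> w \<and> R u w \<longrightarrow> c u \<noteq> c w)"
  using assms(1,3)
proof (induction V)
  case empty
  then show ?case by auto
next
  case (insert x V)
  have "card {w \<in> V. w \<noteq> u \<and> R u w} \<le> d" if "u \<in> V" for u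
  proof -
    have "card {w \<in> V. w \<noteq> u \<and> R u w} \<le> card {w \<in> insert x V. w \<noteq> u \<and> R u w}"
      using insert.hyps by (intro card_mono) auto
    then show ?thesis
      using insert.prems[of u] that by simp
  qed
  from insert.IH[OF this] obtain c
    where c: "c ` V \<subseteq> {1..d + 1}" "\<forall>u\<in>V. \<forall>w\<in>V. u \<noteq> w \<and> R u w \<longrightarrow> c u \<noteq> c w"
    by blast
  let ?N = "{w \<in> insert x V. w \<noteq> x \<and> R x w}"
  have "card (c ` ?N) \<le> d"
    using insert.prems[of x] insert.hyps card_image_le[of ?N c] by fastforce
  \<comment> \<open>Pigeonhole: the neighbors of \<open>x\<close> use at most \<open>d\<close>
    colors.\<close>
  then have "\<not> {1..d + 1} \<subseteq> c ` ?N"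
    using card_mono[of "c ` ?N" "{1..d + 1}"] insert.hyps by auto
  then obtain k where k: "k \<in> {1..d + 1}" "k \<notin> c ` ?N"
    by blast
  have "(c(x := k)) ` insert x V \<subseteq> {1..d + 1}"
    using c(1) k(1) by auto
  moreover have "(c(x := k)) u \<noteq> (c(x := k)) w"
    if "u \<in> insert x V" "w \<in> insert x V" "u \<noteq> w" "R u w" for u w
    \<comment> \<open>Symmetry covers the case \<open>w = x\<close>, where \<open>u\<close> has to
      be recognized as a member of \<open>?N\<close>.\<close>
    using that c(2) k(2) sympD[OF assms(2) that(4)] by auto
  ultimately show ?case by blast
qed

lemma degree_le_max_degree:
  assumes "finite S" "u \<in> S"
  shows "degree E u \<le> max_degree E S"
  unfolding max_degree_def using assms by (intro cSUP_upper) auto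

lemma max_degree_mono:
  assumes "finite T" "S \<subseteq> T"
  shows "max_degree E S \<le> max_degree E T"
\<comment> \<open>Monotonicity of a conditional supremum requires a nonempty index set; over the
  empty set the supremum is 0.\<close>
proof (cases "S = {}")
  case True
  then show ?thesis by (simp add: max_degree_def)
next
  case False
  then show ?thesis
    unfolding max_degree_def using assms by (intro cSUP_subset_mono) auto
qed

lemma simple_graph_finite:
  assumes "simple_graph V E"
  shows "finite E"
  using assms finite_subset[of E "Pow V"] by (auto simp: simple_graph_def)

lemma injective_chromatic_index_le_side:
  fixes V1 V2 :: "'a set"
  assumes graph: "simple_graph (V1 \<union> V2) E" and bip: "bipartition E V1 V2"
  shows "injective_chromatic_index E \<le> max_degree E V1 * (max_degree E V2 - 1) + 1"
proof -
  let ?d = "max_degree E V1 * (max_degree E V2 - 1)"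
  define R where "R u w \<longleftrightarrow> (\<exists>v\<in>V2. {u, v} \<in> E \<and> {w, v} \<in> E)" for u w
  have fin: "finite V1" "finite V2" "finite E"
    using graph simple_graph_finite[OF graph] by (auto simp: simple_graph_def)
  have disj: "V1 \<inter> V2 = {}"
    using bip by (simp add: bipartition_def)
  have "card {w \<in> V1. w \<noteq> u \<and> R u w} \<le> ?d" if u: "u \<in> V1" for u
  proof -
    \<comment> \<open>Count in two stages: first the neighbors \<open>v\<close> of \<open>u\<close>,
      then the other neighbors \<open>w\<close> of each such \<open>v\<close>.\<close>
    define N where "N = {v \<in> V2. {u, v} \<in> E}"
    have "card N \<le> degree E u"
      unfolding degree_def N_def using fin
      by (intro card_inj_on_le[where f = "\<lambda>v. {u, v}"]) (auto simp: inj_on_def doubleton_eq_iff)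
    then have N: "finite N" "card N \<le> max_degree E V1"
      using fin degree_le_max_degree[OF fin(1) u, of E] by (auto simp: N_def)
    have M: "card {w \<in> V1. w \<noteq> u \<and> {w, v} \<in> E} \<le> max_degree E V2 - 1" if v: "v \<in> N" for v
    proof -
      \<comment> \<open>Each \<open>w\<close> is charged to the edge \<open>{w, v}\<close>. The edge
        \<open>{u, v}\<close> is at \<open>v\<close> but is never charged since
        \<open>w \<noteq> u\<close>, which gives the \<open>- 1\<close>.\<close>
      have "card {w \<in> V1. w \<noteq> u \<and> {w, v} \<in> E} \<le> card ({e \<in> E. v \<in> e} - {{u, v}})"
      proof (rule card_inj_on_le)
        show "inj_on (\<lambda>w. {w, v}) {w \<in> V1. w \<noteq> u \<and> {w, v} \<in> E}"
          by (rule inj_onI) (auto simp: doubleton_eq_iff)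
        show "(\<lambda>w. {w, v}) ` {w \<in> V1. w \<noteq> u \<and> {w, v} \<in> E} \<subseteq> {e \<in> E. v \<in> e} - {{u, v}}"
          by (fastforce simp: doubleton_eq_iff)
        show "finite ({e \<in> E. v \<in> e} - {{u, v}})"
          using fin by simp
      qed
      also have "\<dots> = degree E v - 1"
        using v fin by (simp add: degree_def N_def)
      also have "\<dots> \<le> max_degree E V2 - 1"
        using degree_le_max_degree[OF fin(2), of v E] v by (simp add: N_def diff_le_mono)
      finally show ?thesis .
    qed
    have "{w \<in> V1. w \<noteq> u \<and> R u w} = (\<Union>v\<in>N. {w \<in> V1. w \<noteq> u \<and> {w, v} \<in> E})"
      by (auto simp: R_def N_def)
    then have "card {w \<in> V1. w \<noteq> u \<and> R u w} \<le> (\<Sum>v\<in>N. card {w \<in> V1. w \<noteq> u \<and> {w, v} \<in> E})"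
      by (simp only: card_UN_le[OF N(1)])
    also have "\<dots> \<le> card N * (max_degree E V2 - 1)"
      using sum_bounded_above[of N _ "max_degree E V2 - 1"] M by simp
    also have "\<dots> \<le> ?d"
      using N(2) by (rule mult_le_mono1)
    finally show ?thesis .
  qed
  moreover have "symp R"
    by (auto simp: symp_def R_def)
  ultimately obtain c
    where c: "c ` V1 \<subseteq> {1..?d + 1}" "\<forall>u\<in>V1. \<forall>w\<in>V1. u \<noteq> w \<and> R u w \<longrightarrow> c u \<noteq> c w"
    using greedy_coloring[OF fin(1), of R ?d] by blast
  \<comment> \<open>On an edge the intersection is a singleton because the sides are disjoint;
    values on other sets are irrelevant.\<close>
  define col where "col e = c (the_elem (e \<inter> V1))" for e
  have col: "col {u, v} = c u" "col {v, u} = c u" if "u \<in> V1" "v \<in> V2" for u v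
  proof -
    have "{u, v} \<inter> V1 = {u}" "{v, u} \<inter> V1 = {u}"
      using that disj by auto
    then show "col {u, v} = c u" "col {v, u} = c u"
      by (simp_all add: col_def)
  qed
  have side: "a \<in> V1 \<and> b \<in> V2 \<or> a \<in> V2 \<and> b \<in> V1" if ab: "{a, b} \<in> E" for a b
  proof -
    obtain u v where "u \<in> V1" "v \<in> V2" "{a, b} = {u, v}"
      using bip ab unfolding bipartition_def by blast
    then show ?thesis
      unfolding doubleton_eq_iff by blast
  qed
  have "col e1 \<noteq> col e3" if consec: "consecutive E e1 e2 e3" for e1 e2 e3
  proof -
    from consec have E: "e1 \<in> E" "e2 \<in> E" "e3 \<in> E"
      by (simp_all add: consecutive_def)
    consider
      (triangle) x y z where "distinct [x, y, z]" "e1 = {x, y}" "e2 = {y, z}" "e3 = {z, x}"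
      | (path) x y z w where "distinct [x, y, z, w]" "e1 = {x, y}" "e2 = {y, z}" "e3 = {z, w}"
      using consec unfolding consecutive_def by blast
    then show ?thesis
    proof cases
      \<comment> \<open>Vertices alternate between the two sides along edges, so no odd cycle
        exists.\<close>
      case triangle
      then show ?thesis
        using E side[of x y] side[of y z] side[of z x] disj by blast
    next
      case path
      have edges: "{x, y} \<in> E" "{y, z} \<in> E" "{z, w} \<in> E"
        using E path by simp_all
      then have flip: "{z, y} \<in> E" "{w, z} \<in> E"
        by (simp_all add: insert_commute)
      \<comment> \<open>By alternation the \<open>V1\<close>-endpoints of \<open>e1\<close> and
        \<open>e3\<close> are \<open>x\<close>, \<open>z\<close> with common neighbor
        \<open>y\<close>, or \<open>y\<close>, \<open>w\<close> with common neighbor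
        \<open>z\<close>.\<close>
      from side[OF edges(1)] side[OF edges(2)] side[OF edges(3)] disj
      consider (left) "x \<in> V1" "y \<in> V2" "z \<in> V1" "w \<in> V2"
        | (right) "x \<in> V2" "y \<in> V1" "z \<in> V2" "w \<in> V1"
        by blast
      then show ?thesis
      proof cases
        case left
        then have "R x z"
          unfolding R_def using edges(1) flip(1) by blast
        then show ?thesis
          using left path c(2) by (simp add: col)
      next
        case right
        then have "R y w"
          unfolding R_def using edges(2) flip(2) by blast
        then show ?thesis
          using right path c(2) by (simp add: col)
      qed
    qed
  qed
  moreover have "col ` E \<subseteq> {1..?d + 1}"
  proof
    fix k assume "k \<in> col ` E"
    then obtain u v where "u \<in> V1" "v \<in> V2" "k = col {u, v}"
      using bip by (auto simp: bipartition_def)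
    then show "k \<in> {1..?d + 1}"
      using c(1) col by auto
  qed
  ultimately have "injective_edge_coloring E (?d + 1) col"
    by (auto simp: injective_edge_coloring_def)
  then show ?thesis
    unfolding injective_chromatic_index_def by (intro Least_le) blast
qed

theorem proposition1p12:
  fixes V1 V2 :: "'a set" and E :: "'a set set"
  assumes "simple_graph (V1 \<union> V2) E"
    and "bipartition E V1 V2"
    and "\<And>u. u \<in> V1 \<union> V2 \<Longrightarrow> degree E u \<noteq> 0"
  shows "(max_degree E (V1 \<union> V2) \<ge> 3 \<longrightarrow>
           injective_chromatic_index E \<le>
             min (max_degree E V1 * (max_degree E V2 - 1))
                 (max_degree E V2 * (max_degree E V1 - 1)) + 1) \<and>
         (max_degree E (V1 \<union> V2) = 2 \<longrightarrow> injective_chromatic_index E \<le> 3)"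
proof -
  have 1: "injective_chromatic_index E \<le> max_degree E V1 * (max_degree E V2 - 1) + 1"
    using assms(1,2) by (rule injective_chromatic_index_le_side)
  have "bipartition E V2 V1"
    using assms(2) unfolding bipartition_def by (metis inf_commute insert_commute)
  then have 2: "injective_chromatic_index E \<le> max_degree E V2 * (max_degree E V1 - 1) + 1"
    using assms(1) by (intro injective_chromatic_index_le_side) (simp_all add: Un_commute)
  have "injective_chromatic_index E \<le> 3" if "max_degree E (V1 \<union> V2) = 2"
  proof -
    have "max_degree E V1 \<le> 2" "max_degree E V2 \<le> 2"
      using assms(1) that max_degree_mono[of "V1 \<union> V2" V1 E] max_degree_mono[of "V1 \<union> V2" V2 E]
      by (auto simp: simple_graph_def)
    \<comment> \<open>One side's bound is enough here: 2 * (2 - 1) + 1 = 3.\<close>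
    then have "max_degree E V1 * (max_degree E V2 - 1) \<le> 2 * 1"
      by (intro mult_le_mono) auto
    with 1 show ?thesis by simp
  qed
  with 1 2 show ?thesis by (simp add: min_def)
qed

end
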